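(* Let $\eta,\mu$ be real parameters, let $a<b$ and $T>0$. Consider the QAV system $$u_t=\partial_x\left(-\frac{\eta}{6}q-\frac{\eta}{3}u^2-\mu^2u_{xx}\right),\qquad q_t=2u\,u_t, \qquad x\in[a,b],\ t\in[0,T],$$ with periodic boundary conditions in $x$ and the consistent initial condition $q(x,0)=\big(u(x,0)\big)^2$ for all $x\in[a,b]$. Then this system is equivalent to the original model $$u_t=\partial_x\left(-\frac{\eta}{2}u^2-\mu^2u_{xx}\right)$$ with periodic boundary conditions; that is, a pair $(u,q)$ of smooth periodic functions solves the QAV system with the consistent initial condition if and only if $u$ solves the original model and $q=u^2$. Moreover, it conserves the original energy: for every such solution, $$\mathcal{H}(t)=\mathcal{H}(0)\quad\text{for all } t\in[0,T],\qquad \mathcal{H}(t)=\int_a^b\left(-\frac{\eta}{6}u(x,t)^3+\frac{\mu^2}{2}u_x(x,t)^2\right)\mathrm{d}x .$$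
   Context: All functions are real-valued and smooth on $[a,b]\times[0,T]$. "Periodic boundary conditions in $x$" means that the functions extend to smooth $(b-a)$-periodic functions of $x$ on $\mathbb{R}$. The original model is the Korteweg-de Vries equation $u_t+\eta u u_x+\mu^2u_{xxx}=0$ written in the Hamiltonian form $u_t=\partial_x\frac{\delta\mathcal{H}}{\delta u}$ with $\frac{\delta\mathcal{H}}{\delta u}=-\frac{\eta}{2}u^2-\mu^2u_{xx}$. *)

theory Defs
  imports "HOL-Analysis.Analysis"
begin

text \<open>
  Functions of \<open>(x, t)\<close> are curried, \<open>f x t\<close>. Partial derivatives are taken within
  closed intervals \<open>X\<close> (space) and \<open>S\<close> (time), so they are one-sided at the endpoints;
  for \<open>X = UNIV\<close> they are the ordinary ones.
\<close>

definition partial_x :: "real set \<Rightarrow> (real \<Rightarrow> real \<Rightarrow> real) \<Rightarrow> real \<Rightarrow> real \<Rightarrow> real"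
  where "partial_x X f x t = vector_derivative (\<lambda>y. f y t) (at x within X)"

definition partial_t :: "real set \<Rightarrow> (real \<Rightarrow> real \<Rightarrow> real) \<Rightarrow> real \<Rightarrow> real \<Rightarrow> real"
  where "partial_t S f x t = vector_derivative (\<lambda>s. f x s) (at t within S)"

primrec C_k_on :: "nat \<Rightarrow> real set \<Rightarrow> real set \<Rightarrow> (real \<Rightarrow> real \<Rightarrow> real) \<Rightarrow> bool"
  where
    "C_k_on 0 X S f \<longleftrightarrow> continuous_on (X \<times> S) (\<lambda>(x, t). f x t)"
  | "C_k_on (Suc k) X S f \<longleftrightarrow>
       continuous_on (X \<times> S) (\<lambda>(x, t). f x t) \<and>
       (\<forall>x\<in>X. \<forall>t\<in>S. (\<lambda>y. f y t) differentiable (at x within X)) \<and>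
       (\<forall>x\<in>X. \<forall>t\<in>S. (\<lambda>s. f x s) differentiable (at t within S)) \<and>
       C_k_on k X S (partial_x X f) \<and>
       C_k_on k X S (partial_t S f)"

definition smooth_on :: "real set \<Rightarrow> real set \<Rightarrow> (real \<Rightarrow> real \<Rightarrow> real) \<Rightarrow> bool"
  where "smooth_on X S f \<longleftrightarrow> (\<forall>k. C_k_on k X S f)"

definition periodic_bc :: "real \<Rightarrow> real \<Rightarrow> real \<Rightarrow> (real \<Rightarrow> real \<Rightarrow> real) \<Rightarrow> bool"
  where "periodic_bc a b T f \<longleftrightarrow>
    (\<exists>g. smooth_on UNIV {0..T} g \<and>
         (\<forall>x. \<forall>t\<in>{0..T}. g (x + (b - a)) t = g x t) \<and>
         (\<forall>x\<in>{a..b}. \<forall>t\<in>{0..T}. g x t = f x t))"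

definition smooth_periodic :: "real \<Rightarrow> real \<Rightarrow> real \<Rightarrow> (real \<Rightarrow> real \<Rightarrow> real) \<Rightarrow> bool"
  where "smooth_periodic a b T f \<longleftrightarrow> smooth_on {a..b} {0..T} f \<and> periodic_bc a b T f"

definition kdv_solution ::
    "real \<Rightarrow> real \<Rightarrow> real \<Rightarrow> real \<Rightarrow> real \<Rightarrow> (real \<Rightarrow> real \<Rightarrow> real) \<Rightarrow> bool"
  where "kdv_solution \<eta> \<mu> a b T u \<longleftrightarrow>
    smooth_periodic a b T u \<and>
    (\<forall>x\<in>{a..b}. \<forall>t\<in>{0..T}.
       partial_t {0..T} u x t =
       partial_x {a..b}
         (\<lambda>x t. - (\<eta> / 2) * (u x t)\<^sup>2
                - \<mu>\<^sup>2 * partial_x {a..b} (partial_x {a..b} u) x t) x t)"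

definition qav_solution ::
    "real \<Rightarrow> real \<Rightarrow> real \<Rightarrow> real \<Rightarrow> real \<Rightarrow>
     (real \<Rightarrow> real \<Rightarrow> real) \<Rightarrow> (real \<Rightarrow> real \<Rightarrow> real) \<Rightarrow> bool"
  where "qav_solution \<eta> \<mu> a b T u q \<longleftrightarrow>
    smooth_periodic a b T u \<and> smooth_periodic a b T q \<and>
    (\<forall>x\<in>{a..b}. \<forall>t\<in>{0..T}.
       partial_t {0..T} u x t =
       partial_x {a..b}
         (\<lambda>x t. - (\<eta> / 6) * q x t - (\<eta> / 3) * (u x t)\<^sup>2
                - \<mu>\<^sup>2 * partial_x {a..b} (partial_x {a..b} u) x t) x t) \<and>
    (\<forall>x\<in>{a..b}. \<forall>t\<in>{0..T}.
       partial_t {0..T} q x t = 2 * u x t * partial_t {0..T} u x t)"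

definition consistent_initial ::
    "real \<Rightarrow> real \<Rightarrow> (real \<Rightarrow> real \<Rightarrow> real) \<Rightarrow> (real \<Rightarrow> real \<Rightarrow> real) \<Rightarrow> bool"
  where "consistent_initial a b u q \<longleftrightarrow> (\<forall>x\<in>{a..b}. q x 0 = (u x 0)\<^sup>2)"

definition energy ::
    "real \<Rightarrow> real \<Rightarrow> real \<Rightarrow> real \<Rightarrow> (real \<Rightarrow> real \<Rightarrow> real) \<Rightarrow> real \<Rightarrow> real"
  where "energy \<eta> \<mu> a b u t =
    integral {a..b} (\<lambda>x. - (\<eta> / 6) * (u x t) ^ 3 + \<mu>\<^sup>2 / 2 * (partial_x {a..b} u x t)\<^sup>2)"

end

theory Submission imports Defs begin

text \<open>
  Along a QAV solution \<open>\<partial>\<^sub>t (q - u\<^sup>2) = 0\<close>, so the consistent initial condition forces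
  \<open>q = u\<^sup>2\<close>, and substituting this turns \<open>- (\<eta>/6) q - (\<eta>/3) u\<^sup>2\<close> into \<open>- (\<eta>/2) u\<^sup>2\<close>.
  For the energy, write \<open>F = - (\<eta>/2) u\<^sup>2 - \<mu>\<^sup>2 u\<^sub>x\<^sub>x\<close>, so that \<open>u\<^sub>t = F\<^sub>x\<close>. Then the time derivative
  of the energy density is the exact derivative \<open>\<partial>\<^sub>x (F\<^sup>2/2 + \<mu>\<^sup>2 u\<^sub>x u\<^sub>t)\<close>,
  whose integral over a period vanishes.
\<close>

section \<open>Uniqueness and congruence of derivatives within a set\<close>

text \<open>\<open>vector_derivative\<close> is a choice, and a derivative within \<open>X\<close>
  is unique only where the filter \<open>at x within X\<close> is nontrivial. Closedness of
  \<open>X\<close> is not part of this notion.\<close>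

definition perfect :: "real set \<Rightarrow> bool"
  where "perfect X \<longleftrightarrow> (\<forall>x\<in>X. at x within X \<noteq> bot)"

lemma perfect_UNIV: "perfect UNIV"
  by (simp add: perfect_def)

lemma perfect_Icc: "a < b \<Longrightarrow> perfect {a..b}"
  by (auto simp: perfect_def trivial_limit_within islimpt_Icc)

lemma DERIV_cong_on:
  fixes f g :: "real \<Rightarrow> real"
  assumes "(f has_real_derivative D) (at x within X)" "x \<in> X" "\<And>y. y \<in> X \<Longrightarrow> f y = g y"
  shows "(g has_real_derivative D) (at x within X)"
  using assms unfolding has_field_derivative_def
  by (metis (no_types, lifting) has_derivative_transform)

lemma partial_x_eqI:
  assumes "perfect X" "x \<in> X" "((\<lambda>y. f y t) has_real_derivative D) (at x within X)"
  shows "partial_x X f x t = D"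
  using assms unfolding perfect_def partial_x_def
  by (metis has_real_derivative_iff_has_vector_derivative vector_derivative_within)

lemma partial_t_eqI:
  assumes "perfect S" "t \<in> S" "((\<lambda>s. f x s) has_real_derivative D) (at t within S)"
  shows "partial_t S f x t = D"
  using assms unfolding perfect_def partial_t_def
  by (metis has_real_derivative_iff_has_vector_derivative vector_derivative_within)

lemma partial_x_cong:
  assumes "x \<in> X" "\<And>y. y \<in> X \<Longrightarrow> f y t = g y t"
  shows "partial_x X f x t = partial_x X g x t"
proof -
  \<comment> \<open>Both functions have the same candidate derivatives, so the choice behind
    \<open>vector_derivative\<close> returns the same value even where no derivative exists.\<close>
  have "((\<lambda>y. f y t) has_real_derivative D) (at x within X) \<longleftrightarrow>
        ((\<lambda>y. g y t) has_real_derivative D) (at x within X)" for D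
    using assms DERIV_cong_on[of "\<lambda>y. f y t"] DERIV_cong_on[of "\<lambda>y. g y t"] by metis
  then show ?thesis
    by (simp add: partial_x_def vector_derivative_def has_real_derivative_iff_has_vector_derivative)
qed

text \<open>The spatial points \<open>x\<close> and \<open>x'\<close> may differ, so that equality
  of \<open>u\<close> at the two endpoints of the period passes to its time derivative.\<close>

lemma partial_t_cong:
  assumes "t \<in> S" "\<And>s. s \<in> S \<Longrightarrow> f x s = g x' s"
  shows "partial_t S f x t = partial_t S g x' t"
proof -
  have "((\<lambda>s. f x s) has_real_derivative D) (at t within S) \<longleftrightarrow>
        ((\<lambda>s. g x' s) has_real_derivative D) (at t within S)" for D
    using assms DERIV_cong_on[of "\<lambda>s. f x s"] DERIV_cong_on[of "\<lambda>s. g x' s"] by metis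
  then show ?thesis
    by (simp add: partial_t_def vector_derivative_def has_real_derivative_iff_has_vector_derivative)
qed

section \<open>Calculus of C^k and smooth functions\<close>

lemma C_k_on_continuous: "C_k_on k X S f \<Longrightarrow> continuous_on (X \<times> S) (\<lambda>(x, t). f x t)"
  by (cases k) auto

lemma C_k_on_SucD: "C_k_on (Suc k) X S f \<Longrightarrow> C_k_on k X S f"
proof (induction k arbitrary: f)
  case (Suc k)
  have "C_k_on k X S (partial_x X f)" "C_k_on k X S (partial_t S f)"
    using Suc.prems by (auto simp only: C_k_on.simps(2)[of "Suc k"] intro: Suc.IH)
  then show ?case
    using Suc.prems unfolding C_k_on.simps by blast
qed simp

lemma C_k_on_has_partial_x:
  assumes "C_k_on (Suc k) X S f" "x \<in> X" "t \<in> S"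
  shows "((\<lambda>y. f y t) has_real_derivative partial_x X f x t) (at x within X)"
  using assms
  by (simp add: partial_x_def has_real_derivative_iff_has_vector_derivative
      vector_derivative_works[symmetric])

lemma C_k_on_has_partial_t:
  assumes "C_k_on (Suc k) X S f" "x \<in> X" "t \<in> S"
  shows "((\<lambda>s. f x s) has_real_derivative partial_t S f x t) (at t within S)"
  using assms
  by (simp add: partial_t_def has_real_derivative_iff_has_vector_derivative
      vector_derivative_works[symmetric])

text \<open>Continuity and all derivatives are taken within \<open>X\<close> and \<open>S\<close>,
  so values off \<open>X \<times> S\<close> never enter.\<close>

lemma C_k_on_cong:
  assumes "\<And>x t. x \<in> X \<Longrightarrow> t \<in> S \<Longrightarrow> f x t = g x t" "C_k_on k X S f"
  shows "C_k_on k X S g"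
  using assms
proof (induction k arbitrary: f g)
  case 0
  then show ?case
    by (auto intro: continuous_on_eq)
next
  case (Suc k)
  have "continuous_on (X \<times> S) (\<lambda>(x, t). g x t)"
    using Suc.prems by (auto intro: continuous_on_eq)
  moreover have "(\<lambda>y. g y t) differentiable (at x within X)" if x: "x \<in> X" and t: "t \<in> S" for x t
    unfolding real_differentiable_def
    using DERIV_cong_on[OF C_k_on_has_partial_x[OF Suc.prems(2) x t] x Suc.prems(1)] t by blast
  moreover have "(\<lambda>s. g x s) differentiable (at t within S)" if x: "x \<in> X" and t: "t \<in> S" for x t
    unfolding real_differentiable_def
    using DERIV_cong_on[OF C_k_on_has_partial_t[OF Suc.prems(2) x t] t Suc.prems(1)] x by blast
  moreover have "C_k_on k X S (partial_x X g)"
  proof (rule Suc.IH)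
    show "partial_x X f x t = partial_x X g x t" if "x \<in> X" "t \<in> S" for x t
      using Suc.prems(1) that by (intro partial_x_cong)
    show "C_k_on k X S (partial_x X f)"
      using Suc.prems(2) by simp
  qed
  moreover have "C_k_on k X S (partial_t S g)"
  proof (rule Suc.IH)
    show "partial_t S f x t = partial_t S g x t" if "x \<in> X" "t \<in> S" for x t
      using Suc.prems(1) that by (intro partial_t_cong)
    show "C_k_on k X S (partial_t S f)"
      using Suc.prems(2) by simp
  qed
  ultimately show ?case
    unfolding C_k_on.simps by blast
qed

text \<open>This admits explicit formulas for the partial derivatives: uniqueness on perfect sets
  identifies them with the chosen ones on \<open>X \<times> S\<close>.\<close>

lemma C_k_on_SucI:
  assumes "perfect X" "perfect S"
    and "continuous_on (X \<times> S) (\<lambda>(x, t). f x t)"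
    and fx: "\<And>x t. x \<in> X \<Longrightarrow> t \<in> S \<Longrightarrow> ((\<lambda>y. f y t) has_real_derivative fx x t) (at x within X)"
    and ft: "\<And>x t. x \<in> X \<Longrightarrow> t \<in> S \<Longrightarrow> ((\<lambda>s. f x s) has_real_derivative ft x t) (at t within S)"
    and "C_k_on k X S fx" "C_k_on k X S ft"
  shows "C_k_on (Suc k) X S f"
proof -
  have "C_k_on k X S (partial_x X f)"
    using partial_x_eqI[OF assms(1) _ fx, symmetric] assms(6) by (rule C_k_on_cong)
  moreover have "C_k_on k X S (partial_t S f)"
    using partial_t_eqI[OF assms(2) _ ft, symmetric] assms(7) by (rule C_k_on_cong)
  moreover have "(\<lambda>y. f y t) differentiable (at x within X)" if "x \<in> X" "t \<in> S" for x t
    using fx[OF that] real_differentiable_def by blast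
  moreover have "(\<lambda>s. f x s) differentiable (at t within S)" if "x \<in> X" "t \<in> S" for x t
    using ft[OF that] real_differentiable_def by blast
  ultimately show ?thesis
    using assms by simp
qed

lemma C_k_on_add:
  assumes "perfect X" "perfect S" "C_k_on k X S f" "C_k_on k X S g"
  shows "C_k_on k X S (\<lambda>x t. f x t + g x t)"
  using assms(3,4)
proof (induction k arbitrary: f g)
  case 0
  then show ?case
    by (auto simp: case_prod_beta intro!: continuous_intros)
next
  case (Suc k)
  have cont: "continuous_on (X \<times> S) (\<lambda>(x, t). f x t + g x t)"
    using Suc.prems[THEN C_k_on_continuous] by (auto simp: case_prod_beta intro!: continuous_intros)
  have x: "C_k_on k X S (\<lambda>x t. partial_x X f x t + partial_x X g x t)"
    using Suc.prems by (intro Suc.IH) auto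
  have t: "C_k_on k X S (\<lambda>x t. partial_t S f x t + partial_t S g x t)"
    using Suc.prems by (intro Suc.IH) auto
  show ?case
    by (rule C_k_on_SucI[OF assms(1,2) cont _ _ x t])
      (auto intro!: DERIV_add Suc.prems[THEN C_k_on_has_partial_x] Suc.prems[THEN C_k_on_has_partial_t])
qed

lemma C_k_on_mult:
  assumes "perfect X" "perfect S" "C_k_on k X S f" "C_k_on k X S g"
  shows "C_k_on k X S (\<lambda>x t. f x t * g x t)"
  using assms(3,4)
proof (induction k arbitrary: f g)
  case 0
  then show ?case
    by (auto simp: case_prod_beta intro!: continuous_intros)
next
  case (Suc k)
  \<comment> \<open>The product rule leaves one factor undifferentiated, and the induction
    hypothesis needs that factor at order \<open>k\<close>.\<close>
  note D = Suc.prems[THEN C_k_on_SucD]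
  have cont: "continuous_on (X \<times> S) (\<lambda>(x, t). f x t * g x t)"
    using Suc.prems[THEN C_k_on_continuous] by (auto simp: case_prod_beta intro!: continuous_intros)
  have x: "C_k_on k X S (\<lambda>x t. f x t * partial_x X g x t + partial_x X f x t * g x t)"
    using Suc.prems D by (intro C_k_on_add Suc.IH assms(1,2)) auto
  have t: "C_k_on k X S (\<lambda>x t. f x t * partial_t S g x t + partial_t S f x t * g x t)"
    using Suc.prems D by (intro C_k_on_add Suc.IH assms(1,2)) auto
  show ?case
    by (rule C_k_on_SucI[OF assms(1,2) cont _ _ x t])
      (auto intro!: DERIV_mult' Suc.prems[THEN C_k_on_has_partial_x] Suc.prems[THEN C_k_on_has_partial_t])
qed

lemma smooth_on_mult:
  "perfect X \<Longrightarrow> perfect S \<Longrightarrow> smooth_on X S f \<Longrightarrow> smooth_on X S g \<Longrightarrow>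
    smooth_on X S (\<lambda>x t. f x t * g x t)"
  by (simp add: smooth_on_def C_k_on_mult)

lemma smooth_on_cong:
  "(\<And>x t. x \<in> X \<Longrightarrow> t \<in> S \<Longrightarrow> f x t = g x t) \<Longrightarrow> smooth_on X S f \<Longrightarrow> smooth_on X S g"
  unfolding smooth_on_def using C_k_on_cong by blast

lemma smooth_on_partial_x: "smooth_on X S f \<Longrightarrow> smooth_on X S (partial_x X f)"
  unfolding smooth_on_def by (meson C_k_on.simps(2))

lemma smooth_on_partial_t: "smooth_on X S f \<Longrightarrow> smooth_on X S (partial_t S f)"
  unfolding smooth_on_def by (meson C_k_on.simps(2))

lemma smooth_on_continuous: "smooth_on X S f \<Longrightarrow> continuous_on (X \<times> S) (\<lambda>(x, t). f x t)"
  unfolding smooth_on_def using C_k_on_continuous by blast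

lemma smooth_on_continuous_x:
  assumes "smooth_on X S f" "t \<in> S"
  shows "continuous_on X (\<lambda>x. f x t)"
proof -
  have "continuous_on X (\<lambda>x. (x, t))"
    by (intro continuous_intros)
  from continuous_on_compose2[OF smooth_on_continuous[OF assms(1)] this] show ?thesis
    using assms(2) by auto
qed

text \<open>The Leibniz rule takes the parameter \<open>t\<close> as first coordinate, whereas
  functions here take \<open>x\<close> first.\<close>

lemma smooth_on_continuous_swap:
  assumes "smooth_on X S f"
  shows "continuous_on (S \<times> X) (\<lambda>(t, x). f x t)"
proof -
  have "continuous_on (S \<times> X) prod.swap"
    by (rule continuous_on_swap)
  from continuous_on_compose2[OF smooth_on_continuous[OF assms] this] show ?thesis
    by (simp add: case_prod_beta product_swap)
qed

lemma smooth_on_has_partial_x: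
  "smooth_on X S f \<Longrightarrow> x \<in> X \<Longrightarrow> t \<in> S \<Longrightarrow>
    ((\<lambda>y. f y t) has_real_derivative partial_x X f x t) (at x within X)"
  using C_k_on_has_partial_x unfolding smooth_on_def by blast

lemma smooth_on_has_partial_t:
  "smooth_on X S f \<Longrightarrow> x \<in> X \<Longrightarrow> t \<in> S \<Longrightarrow>
    ((\<lambda>s. f x s) has_real_derivative partial_t S f x t) (at t within S)"
  using C_k_on_has_partial_t unfolding smooth_on_def by blast

section \<open>Differentiation under the integral and mixed partials\<close>

lemma Leibniz_rule_Icc:
  fixes f f' :: "real \<Rightarrow> real \<Rightarrow> real"
  assumes "\<And>x t. x \<in> {a..b} \<Longrightarrow> t \<in> {c..d} \<Longrightarrow>
      ((\<lambda>s. f x s) has_real_derivative f' x t) (at t within {c..d})"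
    and "\<And>t. t \<in> {c..d} \<Longrightarrow> continuous_on {a..b} (\<lambda>x. f x t)"
    and "continuous_on ({c..d} \<times> {a..b}) (\<lambda>(t, x). f' x t)"
    and "t \<in> {c..d}"
  shows "((\<lambda>t. integral {a..b} (\<lambda>x. f x t)) has_real_derivative integral {a..b} (\<lambda>x. f' x t))
    (at t within {c..d})"
  using leibniz_rule_field_derivative[of "{c..d}" a b "\<lambda>t x. f x t" "\<lambda>t x. f' x t" t] assms
  by (auto intro: integrable_continuous_real)

text \<open>
  Differentiating \<open>f(x,t) = f(a,t) + \<integral>\<^sub>a\<^sup>x f\<^sub>x(y,t) dy\<close> under the integral sign gives
  \<open>f\<^sub>t(x,t) = f\<^sub>t(a,t) + \<integral>\<^sub>a\<^sup>x f\<^sub>x\<^sub>t(y,t) dy\<close>.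
\<close>
lemma mixed_partials_commute:
  assumes f: "smooth_on {a..b} {c..d} f" and "c < d" and x: "x \<in> {a..b}" and t: "t \<in> {c..d}"
  shows "((\<lambda>y. partial_t {c..d} f y t) has_real_derivative
      partial_t {c..d} (partial_x {a..b} f) x t) (at x within {a..b})"
proof -
  let ?fx = "partial_x {a..b} f"
  let ?fxt = "partial_t {c..d} ?fx"
  note fx = smooth_on_partial_x[OF f]
  note fxt = smooth_on_partial_t[OF fx]
  have FTC: "f a s + integral {a..y} (\<lambda>z. ?fx z s) = f y s" if y: "y \<in> {a..b}" and s: "s \<in> {c..d}" for y s
  proof -
    have "((\<lambda>z. ?fx z s) has_integral f y s - f a s) {a..y}"
      using smooth_on_has_partial_x[OF f _ s] y
      by (intro fundamental_theorem_of_calculus)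
        (auto simp: has_real_derivative_iff_has_vector_derivative[symmetric]
          intro: DERIV_subset[of _ _ _ "{a..b}"])
    then show ?thesis
      by (simp add: integral_unique)
  qed
  have ft: "partial_t {c..d} f a t + integral {a..y} (\<lambda>z. ?fxt z t) = partial_t {c..d} f y t"
    if y: "y \<in> {a..b}" for y
  proof (rule partial_t_eqI[symmetric])
    have "((\<lambda>s. integral {a..y} (\<lambda>z. ?fx z s)) has_real_derivative
        integral {a..y} (\<lambda>z. ?fxt z t)) (at t within {c..d})"
    proof (rule Leibniz_rule_Icc[OF _ _ _ t])
      show "continuous_on {a..y} (\<lambda>z. ?fx z s)" if "s \<in> {c..d}" for s
        using smooth_on_continuous_x[OF fx that] y by (auto intro: continuous_on_subset)
      show "continuous_on ({c..d} \<times> {a..y}) (\<lambda>(t, x). ?fxt x t)"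
        using y by (intro continuous_on_subset[OF smooth_on_continuous_swap[OF fxt]]) auto
    qed (use smooth_on_has_partial_t[OF fx] y in auto)
    then have "((\<lambda>s. f a s + integral {a..y} (\<lambda>z. ?fx z s)) has_real_derivative
        partial_t {c..d} f a t + integral {a..y} (\<lambda>z. ?fxt z t)) (at t within {c..d})"
      using smooth_on_has_partial_t[OF f _ t, of a] y by (intro DERIV_add) auto
    then show "((\<lambda>s. f y s) has_real_derivative
        partial_t {c..d} f a t + integral {a..y} (\<lambda>z. ?fxt z t)) (at t within {c..d})"
      by (rule DERIV_cong_on[OF _ t FTC[OF y]])
  qed (use \<open>c < d\<close> t perfect_Icc in auto)
  \<comment> \<open>Varying the upper limit recovers the integrand at \<open>x\<close>, by
    continuity of \<open>?fxt\<close> in space.\<close>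
  have "((\<lambda>y. partial_t {c..d} f a t + integral {a..y} (\<lambda>z. ?fxt z t)) has_real_derivative 0 + ?fxt x t)
      (at x within {a..b})"
    by (intro DERIV_add DERIV_const integral_has_real_derivative smooth_on_continuous_x[OF fxt t] x)
  then show ?thesis
    using DERIV_cong_on[OF _ x ft] by simp
qed

section \<open>Periodic extensions\<close>

text \<open>The two-sided derivative of the extension \<open>g\<close> restricts to a derivative
  within \<open>{a..b}\<close>, one-sided at the endpoints, and \<open>a < b\<close> makes the
  latter unique.\<close>

lemma partial_x_UNIV_eq:
  assumes "a < b" "smooth_on UNIV S g" "\<And>y. y \<in> {a..b} \<Longrightarrow> g y t = f y t" "x \<in> {a..b}" "t \<in> S"
  shows "partial_x UNIV g x t = partial_x {a..b} f x t"
proof (rule partial_x_eqI[symmetric])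
  have deriv: "((\<lambda>y. g y t) has_real_derivative partial_x UNIV g x t) (at x within {a..b})"
    using smooth_on_has_partial_x[OF assms(2), of x t] assms(5)
    by (auto intro: has_field_derivative_at_within)
  show "((\<lambda>y. f y t) has_real_derivative partial_x UNIV g x t) (at x within {a..b})"
    by (rule DERIV_cong_on[OF deriv assms(4,3)])
qed (use assms perfect_Icc in auto)

lemma partial_x_periodic:
  assumes "smooth_on UNIV S g" "\<And>x. g (x + p) t = g x t" "t \<in> S"
  shows "partial_x UNIV g (x + p) t = partial_x UNIV g x t"
proof (rule partial_x_eqI[symmetric, OF perfect_UNIV])
  have "((\<lambda>y. g (y + p) t) has_real_derivative partial_x UNIV g (x + p) t) (at x)"
    using smooth_on_has_partial_x[OF assms(1), of "x + p" t] assms(3) by (simp add: DERIV_shift)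
  then show "((\<lambda>y. g y t) has_real_derivative partial_x UNIV g (x + p) t) (at x)"
    by (simp add: assms(2))
qed simp

lemma periodic_bc_boundary:
  assumes "periodic_bc a b T f" "a < b" "t \<in> {0..T}"
  shows "f b t = f a t"
  using assms unfolding periodic_bc_def
  by (metis add.commute atLeastAtMost_iff diff_add_cancel less_eq_real_def)

text \<open>The derivative of the periodic extension of \<open>f\<close> extends the derivative of
  \<open>f\<close>. Iterating this matches u_x and u_xx at the two endpoints.\<close>

lemma periodic_bc_partial_x:
  assumes "periodic_bc a b T f" "a < b"
  shows "periodic_bc a b T (partial_x {a..b} f)"
proof -
  obtain g where g: "smooth_on UNIV {0..T} g" "\<And>x t. t \<in> {0..T} \<Longrightarrow> g (x + (b - a)) t = g x t"
    "\<And>x t. x \<in> {a..b} \<Longrightarrow> t \<in> {0..T} \<Longrightarrow> g x t = f x t"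
    using assms unfolding periodic_bc_def by blast
  show ?thesis
    unfolding periodic_bc_def
    using g assms(2) by (intro exI[of _ "partial_x UNIV g"])
      (auto intro: smooth_on_partial_x partial_x_UNIV_eq partial_x_periodic)
qed

text \<open>Passing from KdV to QAV, smoothness and periodicity of \<open>q\<close> must be proved,
  while \<open>q\<close> is known only on the rectangle. The square of the extension of
  \<open>u\<close> serves as the extension of \<open>q\<close>.\<close>

lemma smooth_periodic_square:
  assumes "a < b" "0 < T" "smooth_periodic a b T u"
    and q: "\<And>x t. x \<in> {a..b} \<Longrightarrow> t \<in> {0..T} \<Longrightarrow> q x t = (u x t)\<^sup>2"
  shows "smooth_periodic a b T q"
proof -
  note perf = perfect_Icc[OF assms(1)] perfect_Icc[OF assms(2)]
  obtain g where g: "smooth_on UNIV {0..T} g" "\<And>x t. t \<in> {0..T} \<Longrightarrow> g (x + (b - a)) t = g x t"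
    "\<And>x t. x \<in> {a..b} \<Longrightarrow> t \<in> {0..T} \<Longrightarrow> g x t = u x t"
    using assms(3) unfolding smooth_periodic_def periodic_bc_def by blast
  have "smooth_on {a..b} {0..T} (\<lambda>x t. u x t * u x t)"
    using assms(3) perf by (intro smooth_on_mult) (auto simp: smooth_periodic_def)
  then have "smooth_on {a..b} {0..T} q"
    by (rule smooth_on_cong[rotated]) (simp add: q power2_eq_square)
  moreover have "periodic_bc a b T q"
    unfolding periodic_bc_def
    using g q smooth_on_mult[OF perfect_UNIV perf(2) g(1,1)]
    by (intro exI[of _ "\<lambda>x t. g x t * g x t"]) (auto simp: power2_eq_square)
  ultimately show ?thesis
    by (simp add: smooth_periodic_def)
qed

section \<open>Equivalence of the QAV system and the KdV equation\<close>

lemma qav_eq_square: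
  assumes "0 < T" "qav_solution \<eta> \<mu> a b T u q" "consistent_initial a b u q"
    and x: "x \<in> {a..b}" and t: "t \<in> {0..T}"
  shows "q x t = (u x t)\<^sup>2"
proof -
  have u: "smooth_on {a..b} {0..T} u" and q: "smooth_on {a..b} {0..T} q"
    and qt: "\<And>s. s \<in> {0..T} \<Longrightarrow> partial_t {0..T} q x s = 2 * u x s * partial_t {0..T} u x s"
    using assms unfolding qav_solution_def smooth_periodic_def by auto
  have "((\<lambda>s. q x s - (u x s)\<^sup>2) has_real_derivative 0) (at s within {0..T})" if s: "s \<in> {0..T}" for s
    using smooth_on_has_partial_t[OF u x s] smooth_on_has_partial_t[OF q x s] qt[OF s]
    by (auto intro!: derivative_eq_intros)
  then obtain c where "\<And>s. s \<in> {0..T} \<Longrightarrow> q x s - (u x s)\<^sup>2 = c"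
    using has_field_derivative_zero_constant[of "{0..T}" "\<lambda>s. q x s - (u x s)\<^sup>2"] by auto
  \<comment> \<open>At time \<open>0\<close> the initial condition gives \<open>c = 0\<close>; time
    \<open>t\<close> then gives the claim.\<close>
  from this[of 0] this[OF t] show ?thesis
    using assms by (auto simp: consistent_initial_def)
qed

text \<open>Taking q = u^2 as a hypothesis serves both directions of the theorem: it is derived from
  the QAV system in one and given in the other.\<close>

lemma qav_solution_iff_kdv_solution:
  assumes "a < b" "0 < T"
    and q: "\<And>x t. x \<in> {a..b} \<Longrightarrow> t \<in> {0..T} \<Longrightarrow> q x t = (u x t)\<^sup>2"
  shows "qav_solution \<eta> \<mu> a b T u q \<longleftrightarrow> kdv_solution \<eta> \<mu> a b T u"
proof -
  have flux: "partial_x {a..b} (\<lambda>x t. - (\<eta> / 6) * q x t - (\<eta> / 3) * (u x t)\<^sup>2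
        - \<mu>\<^sup>2 * partial_x {a..b} (partial_x {a..b} u) x t) x t =
      partial_x {a..b} (\<lambda>x t. - (\<eta> / 2) * (u x t)\<^sup>2
        - \<mu>\<^sup>2 * partial_x {a..b} (partial_x {a..b} u) x t) x t"
    if "x \<in> {a..b}" "t \<in> {0..T}" for x t
    using that by (intro partial_x_cong) (auto simp: q field_simps)
  \<comment> \<open>With q = u^2 the second QAV equation is just the chain rule.\<close>
  have "partial_t {0..T} q x t = 2 * u x t * partial_t {0..T} u x t"
    if u: "smooth_periodic a b T u" and x: "x \<in> {a..b}" and t: "t \<in> {0..T}" for x t
  proof -
    have "((\<lambda>s. (u x s)\<^sup>2) has_real_derivative 2 * u x t * partial_t {0..T} u x t) (at t within {0..T})"
      using u smooth_on_has_partial_t[OF _ x t, of u]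
      by (auto simp: smooth_periodic_def intro!: derivative_eq_intros)
    then have "partial_t {0..T} (\<lambda>x t. (u x t)\<^sup>2) x t = 2 * u x t * partial_t {0..T} u x t"
      using perfect_Icc[OF assms(2)] t by (intro partial_t_eqI) auto
    then show ?thesis
      using partial_t_cong[OF t, of q x "\<lambda>x t. (u x t)\<^sup>2" x] q x by auto
  qed
  then show ?thesis
    unfolding qav_solution_def kdv_solution_def
    using flux smooth_periodic_square[OF assms(1,2) _ q] by auto
qed

section \<open>Conservation of energy\<close>

lemma kdv_energy_constant:
  assumes "a < b" "0 < T" and kdv: "kdv_solution \<eta> \<mu> a b T u" and "t \<in> {0..T}"
  shows "energy \<eta> \<mu> a b u t = energy \<eta> \<mu> a b u 0"
proof -
  have u: "smooth_on {a..b} {0..T} u" and per: "periodic_bc a b T u"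
    using kdv by (auto simp: kdv_solution_def smooth_periodic_def)
  define ux uxx ut uxt where "ux = partial_x {a..b} u" and "uxx = partial_x {a..b} ux"
    and "ut = partial_t {0..T} u" and "uxt = partial_t {0..T} ux"
  note defs = ux_def uxx_def ut_def uxt_def
  define F where "F = (\<lambda>x t. - (\<eta> / 2) * (u x t)\<^sup>2 - \<mu>\<^sup>2 * uxx x t)"
  \<comment> \<open>\<open>w\<close> is the time derivative of the energy density.\<close>
  define w where "w = (\<lambda>x t. - (\<eta> / 2) * (u x t)\<^sup>2 * ut x t + \<mu>\<^sup>2 * ux x t * uxt x t)"
  have smooth: "smooth_on {a..b} {0..T} ux" "smooth_on {a..b} {0..T} uxx"
    "smooth_on {a..b} {0..T} ut" "smooth_on {a..b} {0..T} uxt"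
    unfolding defs by (intro smooth_on_partial_x smooth_on_partial_t u)+
  \<comment> \<open>The equation only fixes the value of \<open>partial_x\<close> on
    \<open>F\<close>. Smoothness of \<open>u\<close> first shows that \<open>F\<close> is
    differentiable, which makes this value a genuine derivative.\<close>
  have F_x: "((\<lambda>y. F y s) has_real_derivative ut x s) (at x within {a..b})"
    if x: "x \<in> {a..b}" and s: "s \<in> {0..T}" for x s
  proof -
    have "((\<lambda>y. F y s) has_real_derivative - (\<eta> / 2) * (2 * u x s * ux x s)
        - \<mu>\<^sup>2 * partial_x {a..b} uxx x s) (at x within {a..b})" (is "(_ has_real_derivative ?D) _")
      unfolding F_def ux_def
      using smooth_on_has_partial_x[OF u x s] smooth_on_has_partial_x[OF smooth(2) x s]
      by (auto intro!: derivative_eq_intros)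
    moreover from this have "partial_x {a..b} F x s = ?D"
      using perfect_Icc[OF assms(1)] x by (intro partial_x_eqI)
    moreover have "ut x s = partial_x {a..b} F x s"
      using kdv x s unfolding kdv_solution_def F_def defs by blast
    ultimately show ?thesis
      by simp
  qed
  have boundary: "u b s = u a s" "ux b s = ux a s" "uxx b s = uxx a s" "ut b s = ut a s"
    if s: "s \<in> {0..T}" for s
  proof -
    note px = periodic_bc_partial_x[OF _ assms(1)] and bd = periodic_bc_boundary[OF _ assms(1)]
    show "u b s = u a s" "ux b s = ux a s" "uxx b s = uxx a s"
      unfolding ux_def uxx_def using bd[OF per s] bd[OF px[OF per] s] bd[OF px[OF px[OF per]] s]
      by simp_all
    \<comment> \<open>On \<open>{0..T}\<close> the functions \<open>u b\<close> and
      \<open>u a\<close> of time coincide, hence so do their derivatives.\<close>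
    show "ut b s = ut a s"
      unfolding ut_def using s bd[OF per] by (rule partial_t_cong)
  qed
  have flux_integral: "integral {a..b} (\<lambda>x. w x s) = 0" if s: "s \<in> {0..T}" for s
  proof -
    \<comment> \<open>Integrating \<mu>^2 u_x u_xt by parts in \<open>x\<close> leaves the boundary
      term \<mu>^2 u_x u_t and the integrand F u_t = F F_x; together they have this
      antiderivative.\<close>
    define G where "G = (\<lambda>x. (F x s)\<^sup>2 / 2 + \<mu>\<^sup>2 * ux x s * ut x s)"
    have "(G has_real_derivative w x s) (at x within {a..b})" if x: "x \<in> {a..b}" for x
    proof -
      \<comment> \<open>\<open>uxt\<close> is defined as the time derivative of u_x, so the order of
        differentiation must be exchanged here.\<close>
      have "((\<lambda>y. ut y s) has_real_derivative uxt x s) (at x within {a..b})"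
        unfolding defs by (rule mixed_partials_commute[OF u assms(2) x s])
      moreover have "((\<lambda>y. ux y s) has_real_derivative uxx x s) (at x within {a..b})"
        unfolding uxx_def by (rule smooth_on_has_partial_x[OF smooth(1) x s])
      ultimately have "(G has_real_derivative
          F x s * ut x s + \<mu>\<^sup>2 * (ux x s * uxt x s + uxx x s * ut x s)) (at x within {a..b})"
        unfolding G_def using F_x[OF x s]
        by (auto intro!: derivative_eq_intros simp: algebra_simps)
      \<comment> \<open>The term -\<mu>^2 u_xx u_t contained in F u_t cancels the last
        summand.\<close>
      moreover have "F x s * ut x s + \<mu>\<^sup>2 * (ux x s * uxt x s + uxx x s * ut x s) = w x s"
        by (simp add: F_def w_def algebra_simps)
      ultimately show ?thesis
        by simp
    qed
    then have "((\<lambda>x. w x s) has_integral G b - G a) {a..b}"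
      using assms(1) by (intro fundamental_theorem_of_calculus)
        (auto simp: has_real_derivative_iff_has_vector_derivative)
    \<comment> \<open>\<open>G\<close> is built from u, u_x, u_xx and u_t alone, all of which agree
      at the two endpoints.\<close>
    moreover have "G b = G a"
      using boundary[OF s] by (simp add: G_def F_def)
    ultimately show ?thesis
      by (simp add: integral_unique)
  qed
  have "(energy \<eta> \<mu> a b u has_real_derivative 0) (at s within {0..T})" if s: "s \<in> {0..T}" for s
  proof -
    have "((\<lambda>s. integral {a..b} (\<lambda>x. - (\<eta> / 6) * u x s ^ 3 + \<mu>\<^sup>2 / 2 * (ux x s)\<^sup>2))
        has_real_derivative integral {a..b} (\<lambda>x. w x s)) (at s within {0..T})"
    proof (rule Leibniz_rule_Icc[OF _ _ _ s])
      show "((\<lambda>s. - (\<eta> / 6) * u x s ^ 3 + \<mu>\<^sup>2 / 2 * (ux x s)\<^sup>2) has_real_derivative w x r)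
          (at r within {0..T})" if x: "x \<in> {a..b}" and r: "r \<in> {0..T}" for x r
        using smooth_on_has_partial_t[OF u x r] smooth_on_has_partial_t[OF smooth(1) x r]
        unfolding w_def ut_def uxt_def
        by (auto intro!: derivative_eq_intros simp: algebra_simps power2_eq_square)
      show "continuous_on {a..b} (\<lambda>x. - (\<eta> / 6) * u x r ^ 3 + \<mu>\<^sup>2 / 2 * (ux x r)\<^sup>2)"
        if "r \<in> {0..T}" for r
        using smooth_on_continuous_x[OF u that] smooth_on_continuous_x[OF smooth(1) that]
        by (intro continuous_intros)
      show "continuous_on ({0..T} \<times> {a..b}) (\<lambda>(t, x). w x t)"
        using u smooth[THEN smooth_on_continuous_swap] smooth_on_continuous_swap[OF u]
        unfolding w_def case_prod_beta by (intro continuous_intros)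
    qed
    then show ?thesis
      unfolding flux_integral[OF s] ux_def by (simp add: energy_def[abs_def])
  qed
  then obtain c where "\<And>s. s \<in> {0..T} \<Longrightarrow> energy \<eta> \<mu> a b u s = c"
    using has_field_derivative_zero_constant[of "{0..T}" "energy \<eta> \<mu> a b u"] by auto
  then show ?thesis
    using assms by auto
qed

theorem theorem2p2:
  fixes \<eta> \<mu> a b T :: real
    and u q :: "real \<Rightarrow> real \<Rightarrow> real"
  assumes "a < b" and "T > 0"
  shows "((qav_solution \<eta> \<mu> a b T u q \<and> consistent_initial a b u q) \<longleftrightarrow>
          (kdv_solution \<eta> \<mu> a b T u \<and> (\<forall>x\<in>{a..b}. \<forall>t\<in>{0..T}. q x t = (u x t)\<^sup>2))) \<and>
         ((qav_solution \<eta> \<mu> a b T u q \<and> consistent_initial a b u q) \<longrightarrow>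
          (\<forall>t\<in>{0..T}. energy \<eta> \<mu> a b u t = energy \<eta> \<mu> a b u 0))"
proof -
  have "(qav_solution \<eta> \<mu> a b T u q \<and> consistent_initial a b u q) \<longleftrightarrow>
      (kdv_solution \<eta> \<mu> a b T u \<and> (\<forall>x\<in>{a..b}. \<forall>t\<in>{0..T}. q x t = (u x t)\<^sup>2))"
    (is "?qav \<longleftrightarrow> ?kdv")
  proof
    assume ?qav
    then show ?kdv
      using qav_eq_square[OF assms(2)] qav_solution_iff_kdv_solution[OF assms] by blast
  next
    assume ?kdv
    then show ?qav
      using qav_solution_iff_kdv_solution[OF assms] assms(2) by (simp add: consistent_initial_def)
  qed
  \<comment> \<open>The equivalence turns a consistent QAV solution into a KdV solution, whose
    energy is constant.\<close>
  then show ?thesis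
    using kdv_energy_constant[OF assms] by blast
qed

end
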